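(* For all $n,m,\ell\ge0$, \[ \mathcal{L}(x^nP_m(x)P_\ell(x))=\sum_{\pi}\mathrm{wt}(\pi), \] where the sum is over all Motzkin–Schröder paths $\pi$ from $(0,m)$ to $(n+\ell,0)$ whose last $\ell$ steps are all vertical down steps or diagonal down steps.
   Context: Let $\{b_n\}_{n\ge0},\{a_n\}_{n\ge0},\{\lambda_n\}_{n\ge0}$ be sequences of complex numbers. Define monic polynomials $P_n(x)$ by $P_{-1}(x)=0$, $P_0(x)=1$ and $P_{n+1}(x)=(x-b_n)P_n(x)-(a_nx+\lambda_n)P_{n-1}(x)$ for $n\ge0$. Let $d_0(x)=1$, $d_m(x)=\prod_{i=1}^m(a_ix+\lambda_i)$, and $Q_m(x)=P_m(x)/d_m(x)$. Assume $a_n\neq0$ and $P_n(-\lambda_n/a_n)\neq 0$ for all $n\ge1$. Let $V=\mathrm{span}\{x^nQ_m(x):n,m\ge0\}$ (rational functions), and let $\mathcal{L}$ be the unique linear functional on $V$ with $\mathcal{L}(1)=1$ and $\mathcal{L}(x^nQ_m(x))=0$ whenever $0\le n<m$. A Motzkin–Schröder path is a lattice path never going below the $x$-axis with steps: up $U=(1,1)$, horizontal $H=(1,0)$, vertical down $V=(0,-1)$, diagonal down $D=(1,-1)$. Its weight $\mathrm{wt}(\pi)$ is the product of step weights: each up step has weight $1$; a horizontal step starting at height $k$ has weight $b_k$; a vertical down step starting at height $k$ has weight $a_k$; a diagonal down step starting at height $k$ has weight $\lambda_k$. *)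

theory Defs
  imports
    Complex_Main
    "HOL-Library.Product_Plus"
    "HOL-Computational_Algebra.Polynomial_Factorial"
begin

text \<open>The \<open>0\<close> branch of the case expression is the convention \<open>P\<^sub>-\<^sub>1 = 0\<close>.\<close>

fun RI_P :: "(nat \<Rightarrow> complex) \<Rightarrow> (nat \<Rightarrow> complex) \<Rightarrow> (nat \<Rightarrow> complex) \<Rightarrow> nat \<Rightarrow> complex poly" where
  "RI_P b a lam 0 = 1"
| "RI_P b a lam (Suc n) =
     [:- b n, 1:] * RI_P b a lam n
     - [:lam n, a n:] * (case n of 0 \<Rightarrow> 0 | Suc k \<Rightarrow> RI_P b a lam k)"

definition RI_d :: "(nat \<Rightarrow> complex) \<Rightarrow> (nat \<Rightarrow> complex) \<Rightarrow> nat \<Rightarrow> complex poly" where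
  "RI_d a lam m = (\<Prod>i=1..m. [:lam i, a i:])"

text \<open>Rational functions are elements of the fraction field of the polynomial ring.\<close>

definition RI_Q :: "(nat \<Rightarrow> complex) \<Rightarrow> (nat \<Rightarrow> complex) \<Rightarrow> (nat \<Rightarrow> complex) \<Rightarrow> nat \<Rightarrow> complex poly fract" where
  "RI_Q b a lam m = Fract (RI_P b a lam m) (RI_d a lam m)"

definition ratfun_scale :: "complex \<Rightarrow> complex poly fract \<Rightarrow> complex poly fract" where
  "ratfun_scale c f = to_fract [:c:] * f"

interpretation ratfun: vector_space ratfun_scale
proof
  fix c d :: complex and f g :: "complex poly fract"
  show "ratfun_scale c (f + g) = ratfun_scale c f + ratfun_scale c g"
    by (simp add: ratfun_scale_def algebra_simps)
  have "to_fract [:c + d:] = to_fract [:c:] + to_fract [:d:]"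
    by (simp flip: to_fract_add)
  then show "ratfun_scale (c + d) f = ratfun_scale c f + ratfun_scale d f"
    by (simp add: ratfun_scale_def algebra_simps)
  have "to_fract [:c * d:] = to_fract [:c:] * to_fract [:d:]"
    by (simp flip: to_fract_mult)
  then show "ratfun_scale c (ratfun_scale d f) = ratfun_scale (c * d) f"
    by (simp add: ratfun_scale_def algebra_simps)
  show "ratfun_scale 1 f = f"
    by (simp add: ratfun_scale_def flip: one_pCons)
qed

definition RI_V :: "(nat \<Rightarrow> complex) \<Rightarrow> (nat \<Rightarrow> complex) \<Rightarrow> (nat \<Rightarrow> complex) \<Rightarrow> complex poly fract set" where
  "RI_V b a lam = ratfun.span {to_fract (monom 1 n) * RI_Q b a lam m |n m. True}"

text \<open>HOL functions are total; nothing is required of the values of \<open>L\<close> outside the subspace.\<close>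

definition linear_functional_on :: "complex poly fract set \<Rightarrow> (complex poly fract \<Rightarrow> complex) \<Rightarrow> bool" where
  "linear_functional_on W L \<longleftrightarrow>
     (\<forall>f\<in>W. \<forall>g\<in>W. L (f + g) = L f + L g) \<and>
     (\<forall>c. \<forall>f\<in>W. L (ratfun_scale c f) = c * L f)"

datatype ms_step = Up | Horizontal | Vertical_Down | Diagonal_Down

primrec ms_vec :: "ms_step \<Rightarrow> int \<times> int" where
  "ms_vec Up = (1, 1)"
| "ms_vec Horizontal = (1, 0)"
| "ms_vec Vertical_Down = (0, - 1)"
| "ms_vec Diagonal_Down = (1, - 1)"

text \<open>A path is given by its initial point and its list of steps.\<close>

primrec ms_path :: "int \<times> int \<Rightarrow> ms_step list \<Rightarrow> int \<times> int \<Rightarrow> bool" where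
  "ms_path p [] q \<longleftrightarrow> 0 \<le> snd p \<and> p = q"
| "ms_path p (s # \<pi>) q \<longleftrightarrow> 0 \<le> snd p \<and> ms_path (p + ms_vec s) \<pi> q"

primrec ms_step_wt :: "(nat \<Rightarrow> complex) \<Rightarrow> (nat \<Rightarrow> complex) \<Rightarrow> (nat \<Rightarrow> complex) \<Rightarrow> nat \<Rightarrow> ms_step \<Rightarrow> complex" where
  "ms_step_wt b a lam k Up = 1"
| "ms_step_wt b a lam k Horizontal = b k"
| "ms_step_wt b a lam k Vertical_Down = a k"
| "ms_step_wt b a lam k Diagonal_Down = lam k"

primrec ms_wt :: "(nat \<Rightarrow> complex) \<Rightarrow> (nat \<Rightarrow> complex) \<Rightarrow> (nat \<Rightarrow> complex) \<Rightarrow> int \<times> int \<Rightarrow> ms_step list \<Rightarrow> complex" where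
  "ms_wt b a lam p [] = 1"
| "ms_wt b a lam p (s # \<pi>) =
     ms_step_wt b a lam (nat (snd p)) s * ms_wt b a lam (p + ms_vec s) \<pi>"

definition last_steps_down :: "nat \<Rightarrow> ms_step list \<Rightarrow> bool" where
  "last_steps_down l \<pi> \<longleftrightarrow>
     l \<le> length \<pi> \<and> set (drop (length \<pi> - l) \<pi>) \<subseteq> {Vertical_Down, Diagonal_Down}"

text \<open>There are only finitely many paths between two given points, so sums over them are genuine.\<close>

lemma ms_path_length:
  "ms_path p \<pi> q \<Longrightarrow> int (length \<pi>) \<le> 2 * (fst q - fst p) - (snd q - snd p)"
proof (induction \<pi> arbitrary: p)
  case (Cons s \<pi>)
  from Cons.prems have "ms_path (p + ms_vec s) \<pi> q" by simp
  from Cons.IH[OF this]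
  have "int (length \<pi>) \<le> 2 * (fst q - fst (p + ms_vec s)) - (snd q - snd (p + ms_vec s))" .
  then show ?case by (cases s) simp_all
qed simp

lemma finite_ms_path: "finite {\<pi>. ms_path p \<pi> q}"
proof (rule finite_subset)
  show "{\<pi>. ms_path p \<pi> q} \<subseteq>
      {\<pi>. set \<pi> \<subseteq> {Up, Horizontal, Vertical_Down, Diagonal_Down} \<and>
          length \<pi> \<le> nat (2 * (fst q - fst p) - (snd q - snd p))}"
  proof clarify
    fix \<pi> assume path: "ms_path p \<pi> q"
    have "s \<in> {Up, Horizontal, Vertical_Down, Diagonal_Down}" for s
      by (cases s) simp_all
    then have "set \<pi> \<subseteq> {Up, Horizontal, Vertical_Down, Diagonal_Down}"
      by (rule subsetI)
    moreover have "length \<pi> \<le> nat (2 * (fst q - fst p) - (snd q - snd p))"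
      using ms_path_length[OF path] by linarith
    ultimately show "set \<pi> \<subseteq> {Up, Horizontal, Vertical_Down, Diagonal_Down} \<and>
        length \<pi> \<le> nat (2 * (fst q - fst p) - (snd q - snd p))" ..
  qed
  show "finite {\<pi>. set \<pi> \<subseteq> {Up, Horizontal, Vertical_Down, Diagonal_Down} \<and>
          length \<pi> \<le> nat (2 * (fst q - fst p) - (snd q - snd p))}"
    by (rule finite_lists_length_le) simp
qed

end

theory Submission imports Defs begin

text \<open>
  Write \<open>M p k = L (p Q\<^sub>k)\<close>. Orthogonality together with the three-term recurrence of the
  \<open>Q\<^sub>k\<close> gives \<open>M p k = coeff p k\<close> whenever \<open>degree p \<le> k\<close>. The recurrence for
  \<open>x P\<^sub>m\<close> is then the first-step recursion of Motzkin--Schroeder paths, so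
  \<open>L (x\<^sup>n P\<^sub>m Q\<^sub>k)\<close> is the weighted count of all paths from \<open>(0,m)\<close> to \<open>(n,k)\<close>.
  Finally \<open>P\<^sub>l = d\<^sub>l Q\<^sub>l\<close>, and expanding \<open>d\<^sub>l = \<Prod>(a\<^sub>i x + \<lambda>\<^sub>i)\<close> appends
  the \<open>l\<close> final down steps: \<open>a\<^sub>i x\<close> is a vertical and \<open>\<lambda>\<^sub>i\<close> a diagonal step.
\<close>

section \<open>Paths and their weighted sums, decomposed at either end\<close>

lemma ms_path_start_nonneg: "ms_path p \<pi> q \<Longrightarrow> 0 \<le> snd p"
  by (cases \<pi>) auto

lemma ms_path_fst_le: "ms_path p \<pi> q \<Longrightarrow> fst p \<le> fst q"
proof (induction \<pi> arbitrary: p)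
  case (Cons s \<pi>)
  from Cons.prems have "ms_path (p + ms_vec s) \<pi> q" by simp
  from Cons.IH[OF this] show ?case by (cases s) simp_all
qed simp

lemma ms_path_snoc:
  "ms_path p (\<pi> @ [s]) q \<longleftrightarrow> ms_path p \<pi> (q - ms_vec s) \<and> 0 \<le> snd q"
  by (induction \<pi> arbitrary: p) (auto simp: eq_diff_eq)

lemma ms_wt_snoc:
  "ms_path p \<pi> q \<Longrightarrow>
    ms_wt b a lam p (\<pi> @ [s]) = ms_wt b a lam p \<pi> * ms_step_wt b a lam (nat (snd q)) s"
  by (induction \<pi> arbitrary: p) auto

lemma last_steps_down_0 [simp]: "last_steps_down 0 \<pi>"
  by (simp add: last_steps_down_def)

lemma last_steps_down_Suc_snoc:
  "last_steps_down (Suc l) (\<pi> @ [s]) \<longleftrightarrow>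
    last_steps_down l \<pi> \<and> s \<in> {Vertical_Down, Diagonal_Down}"
  by (auto simp: last_steps_down_def)

text \<open>End points stay in the integer plane, so a recursion may step to a point below the axis
  or right of the target; the sum there is empty. With \<open>l = 0\<close> all paths are
  counted.\<close>

definition ms_sum ::
  "(nat \<Rightarrow> complex) \<Rightarrow> (nat \<Rightarrow> complex) \<Rightarrow> (nat \<Rightarrow> complex) \<Rightarrow> nat \<Rightarrow> int \<times> int \<Rightarrow> int \<times> int \<Rightarrow> complex"
  where "ms_sum b a lam l p q = (\<Sum>\<pi> | ms_path p \<pi> q \<and> last_steps_down l \<pi>. ms_wt b a lam p \<pi>)"

lemma ms_sum_eq_0_if_negative: "snd p < 0 \<Longrightarrow> ms_sum b a lam l p q = 0"
  unfolding ms_sum_def by (intro sum.neutral) (auto dest: ms_path_start_nonneg)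

lemma ms_sum_eq_0_if_right: "fst q < fst p \<Longrightarrow> ms_sum b a lam l p q = 0"
  unfolding ms_sum_def by (intro sum.neutral) (auto dest: ms_path_fst_le)

lemma ms_sum_first_step:
  assumes "0 \<le> snd p"
  shows "ms_sum b a lam 0 p q = (if p = q then 1 else 0) +
    (\<Sum>s\<in>{Up, Horizontal, Vertical_Down, Diagonal_Down}.
       ms_step_wt b a lam (nat (snd p)) s * ms_sum b a lam 0 (p + ms_vec s) q)"
proof -
  let ?S = "{Up, Horizontal, Vertical_Down, Diagonal_Down}"
  let ?A = "\<lambda>s. {\<pi>. ms_path (p + ms_vec s) \<pi> q}"
  \<comment> \<open>The empty path exists only for \<open>p = q\<close>; all others are sorted by
    their first step.\<close>
  have split: "{\<pi>. ms_path p \<pi> q \<and> last_steps_down 0 \<pi>} =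
      (if p = q then {[]} else {}) \<union> (\<Union>s\<in>?S. Cons s ` ?A s)" (is "?X = _")
  proof (rule set_eqI)
    fix \<pi> show "\<pi> \<in> ?X \<longleftrightarrow> \<pi> \<in> (if p = q then {[]} else {}) \<union> (\<Union>s\<in>?S. Cons s ` ?A s)"
    proof (cases \<pi>)
      case (Cons s \<pi>')
      then show ?thesis using assms by (cases s) auto
    qed (use assms in auto)
  qed
  have "ms_sum b a lam 0 p q = (\<Sum>\<pi>\<in>(if p = q then {[]} else {}). ms_wt b a lam p \<pi>) +
      (\<Sum>\<pi>\<in>(\<Union>s\<in>?S. Cons s ` ?A s). ms_wt b a lam p \<pi>)"
    unfolding ms_sum_def split
    by (intro sum.union_disjoint) (auto simp: finite_ms_path)
  also have "(\<Sum>\<pi>\<in>(\<Union>s\<in>?S. Cons s ` ?A s). ms_wt b a lam p \<pi>) =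
      (\<Sum>s\<in>?S. \<Sum>\<pi>\<in>Cons s ` ?A s. ms_wt b a lam p \<pi>)"
    by (intro sum.UNION_disjoint) (auto simp: finite_ms_path)
  also have "\<dots> = (\<Sum>s\<in>?S. ms_step_wt b a lam (nat (snd p)) s * ms_sum b a lam 0 (p + ms_vec s) q)"
    by (intro sum.cong refl) (simp add: sum.reindex ms_sum_def sum_distrib_left)
  finally show ?thesis by simp
qed

text \<open>A down step ending at \<open>q\<close> starts one level higher, hence the weights with
  index \<open>Suc (nat (snd q))\<close>. Removing it leaves \<open>l\<close> forced down
  steps.\<close>

lemma ms_sum_last_step_down:
  assumes "0 \<le> snd q"
  shows "ms_sum b a lam (Suc l) p q =
    a (Suc (nat (snd q))) * ms_sum b a lam l p (q + (0, 1)) +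
    lam (Suc (nat (snd q))) * ms_sum b a lam l p (q + (-1, 1))"
proof -
  let ?S = "{Vertical_Down, Diagonal_Down}"
  let ?A = "\<lambda>s. {\<pi>. ms_path p \<pi> (q - ms_vec s) \<and> last_steps_down l \<pi>}"
  have fin: "finite (?A s)" for s
    by (rule finite_subset[OF _ finite_ms_path[of p "q - ms_vec s"]]) auto
  have split: "{\<pi>. ms_path p \<pi> q \<and> last_steps_down (Suc l) \<pi>} = (\<Union>s\<in>?S. (\<lambda>\<pi>. \<pi> @ [s]) ` ?A s)"
    (is "?X = ?Y")
  proof (rule set_eqI)
    fix \<pi> show "\<pi> \<in> ?X \<longleftrightarrow> \<pi> \<in> ?Y"
    proof (cases \<pi> rule: rev_cases)
      case Nil then show ?thesis by (auto simp: last_steps_down_def)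
    next
      case (snoc \<pi>' s)
      then show ?thesis using assms by (auto simp: ms_path_snoc last_steps_down_Suc_snoc)
    qed
  qed
  have "ms_sum b a lam (Suc l) p q = (\<Sum>s\<in>?S. \<Sum>\<pi>\<in>(\<lambda>\<pi>. \<pi> @ [s]) ` ?A s. ms_wt b a lam p \<pi>)"
    unfolding ms_sum_def split using fin by (intro sum.UNION_disjoint) auto
  also have "\<dots> = (\<Sum>s\<in>?S. ms_step_wt b a lam (nat (snd (q - ms_vec s))) s *
      ms_sum b a lam l p (q - ms_vec s))"
  proof (intro sum.cong refl)
    fix s
    have "(\<Sum>\<pi>\<in>(\<lambda>\<pi>. \<pi> @ [s]) ` ?A s. ms_wt b a lam p \<pi>) = (\<Sum>\<pi>\<in>?A s. ms_wt b a lam p (\<pi> @ [s]))"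
      by (subst sum.reindex) (auto simp: inj_on_def)
    also have "\<dots> = (\<Sum>\<pi>\<in>?A s. ms_step_wt b a lam (nat (snd (q - ms_vec s))) s * ms_wt b a lam p \<pi>)"
      by (intro sum.cong refl) (auto simp: ms_wt_snoc)
    finally show "(\<Sum>\<pi>\<in>(\<lambda>\<pi>. \<pi> @ [s]) ` ?A s. ms_wt b a lam p \<pi>) =
        ms_step_wt b a lam (nat (snd (q - ms_vec s))) s * ms_sum b a lam l p (q - ms_vec s)"
      by (simp add: ms_sum_def sum_distrib_left)
  qed
  also have "\<dots> = a (Suc (nat (snd q))) * ms_sum b a lam l p (q + (0, 1)) +
    lam (Suc (nat (snd q))) * ms_sum b a lam l p (q + (-1, 1))"
    using assms by (cases q) (simp add: nat_add_distrib)
  finally show ?thesis .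
qed

text \<open>Every step except the vertical one moves right, so the only path inside a single column
  is the straight descent from \<open>m\<close> to \<open>k\<close>.\<close>

lemma ms_sum_vertical:
  "ms_sum b a lam 0 (N, int m) (N, int k) = (if m < k then 0 else \<Prod>i=Suc k..m. a i)"
proof (induction m)
  case 0
  then show ?case
    by (subst ms_sum_first_step) (auto simp: ms_sum_eq_0_if_negative ms_sum_eq_0_if_right)
next
  case (Suc m)
  have "ms_sum b a lam 0 (N, int (Suc m)) (N, int k) =
      (if Suc m = k then 1 else 0) + a (Suc m) * ms_sum b a lam 0 (N, int m) (N, int k)"
    by (subst ms_sum_first_step) (auto simp: ms_sum_eq_0_if_right nat_add_distrib)
  then show ?case unfolding Suc.IH by (auto simp: prod.nat_ivl_Suc' less_Suc_eq not_less)
qed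

section \<open>Degrees and leading coefficients\<close>

lemma RI_P_degree_coeff:
  "degree (RI_P b a lam n) \<le> n \<and> coeff (RI_P b a lam n) n = 1"
proof (induction n rule: less_induct)
  case (less n)
  show ?case
  proof (cases n)
    case (Suc k)
    have k: "degree (RI_P b a lam k) \<le> k" "coeff (RI_P b a lam k) k = 1"
      using less[of k] Suc by auto
    let ?R = "case k of 0 \<Rightarrow> 0 | Suc j \<Rightarrow> RI_P b a lam j"
    \<comment> \<open>The subtracted term cannot reach degree \<open>k + 1\<close>, so the leading
      term comes from \<open>x P_k\<close> alone.\<close>
    have R: "degree ([:lam k, a k:] * ?R) \<le> k"
    proof (cases k)
      case (Suc j)
      then have "degree (RI_P b a lam j) \<le> j" using less[of j] \<open>n = Suc k\<close> by auto
      moreover have "degree [:lam k, a k:] \<le> 1" by simp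
      ultimately show ?thesis
        using degree_mult_le[of "[:lam k, a k:]" "RI_P b a lam j"] Suc by simp
    qed simp
    have X: "degree ([:- b k, 1:] * RI_P b a lam k) \<le> Suc k"
      using degree_mult_le[of "[:- b k, 1:]" "RI_P b a lam k"] k by simp
    have "degree (RI_P b a lam (Suc k)) \<le> Suc k"
      unfolding RI_P.simps using R X by (intro degree_diff_le) auto
    moreover have "coeff (RI_P b a lam (Suc k)) (Suc k) = 1"
      unfolding RI_P.simps coeff_diff using coeff_eq_0[of "[:lam k, a k:] * ?R" "Suc k"] R k
        coeff_eq_0[of "RI_P b a lam k" "Suc k"]
      by (simp add: le_imp_less_Suc)
    ultimately show ?thesis using Suc by simp
  qed simp
qed

lemma RI_P_Suc_Suc:
  "RI_P b a lam (Suc (Suc n)) =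
    [:- b (Suc n), 1:] * RI_P b a lam (Suc n) - [:lam (Suc n), a (Suc n):] * RI_P b a lam n"
  by (simp only: RI_P.simps(2)[of _ _ _ "Suc n"] nat.case)

declare RI_P.simps(2) [simp del]

lemma degree_prod_linear_le: "degree (\<Prod>i=Suc k..m. [:lam i, a i:]) \<le> m - k"
proof -
  have "degree (\<Prod>i=Suc k..m. [:lam i, a i:]) \<le> sum (\<lambda>i. degree [:lam i, a i:]) {Suc k..m}"
    using degree_prod_sum_le[of "{Suc k..m}" "\<lambda>i. [:lam i, a i:]"] by (simp add: o_def)
  also have "\<dots> \<le> sum (\<lambda>i. 1) {Suc k..m}" by (intro sum_mono) simp
  finally show ?thesis by simp
qed

text \<open>\<open>m\<close> and \<open>n\<close> are mere degree bounds: for \<open>i < m\<close>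
  the second factor of a convolution term vanishes, for \<open>i > m\<close> the first.\<close>

lemma coeff_mult_top:
  fixes p q :: "'a::comm_semiring_0 poly"
  assumes "degree p \<le> m" "degree q \<le> n"
  shows "coeff (p * q) (m + n) = coeff p m * coeff q n"
proof -
  have "coeff p i * coeff q (m + n - i) = 0" if "i \<le> m + n" "i \<noteq> m" for i
  proof (cases "i < m")
    case True
    then have "degree q < m + n - i" using assms by linarith
    then show ?thesis by (simp add: coeff_eq_0)
  next
    case False
    then have "degree p < i" using assms that by linarith
    then show ?thesis by (simp add: coeff_eq_0)
  qed
  then have "coeff (p * q) (m + n) = (\<Sum>i\<in>{m}. coeff p i * coeff q (m + n - i))"
    unfolding coeff_mult by (intro sum.mono_neutral_right) auto
  then show ?thesis by simp
qed

lemma coeff_prod_linear: "k \<le> m \<Longrightarrow> coeff (\<Prod>i=Suc k..m. [:lam i, a i:]) (m - k) = (\<Prod>i=Suc k..m. a i)"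
proof (induction m rule: dec_induct)
  case (step m)
  have "coeff ((\<Prod>i=Suc k..m. [:lam i, a i:]) * [:lam (Suc m), a (Suc m):]) (m - k + 1) =
      (\<Prod>i=Suc k..m. a i) * a (Suc m)"
    using step.IH degree_prod_linear_le[of lam a k m] by (subst coeff_mult_top) auto
  then show ?case using step.hyps by (simp add: prod.nat_ivl_Suc' Suc_diff_le mult.commute)
qed simp

lemma RI_d_split: "k \<le> m \<Longrightarrow> RI_d a lam m = RI_d a lam k * (\<Prod>i=Suc k..m. [:lam i, a i:])"
proof -
  assume "k \<le> m"
  then have "{1..m} = {1..k} \<union> {Suc k..m}" by auto
  then show ?thesis by (simp add: RI_d_def prod.union_disjoint)
qed

lemma RI_d_Suc: "RI_d a lam (Suc m) = RI_d a lam m * [:lam (Suc m), a (Suc m):]"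
  by (simp add: RI_d_def)

section \<open>Values of the functional on products of polynomials with \<open>Q k\<close>\<close>

locale RI_functional =
  fixes b a lam :: "nat \<Rightarrow> complex" and L :: "complex poly fract \<Rightarrow> complex"
  assumes a_nz: "\<And>k. k \<ge> 1 \<Longrightarrow> a k \<noteq> 0"
    and L_linear: "linear_functional_on (RI_V b a lam) L"
    and L_one: "L 1 = 1"
    and L_orth: "\<And>i j. i < j \<Longrightarrow> L (to_fract (monom 1 i) * RI_Q b a lam j) = 0"
begin

abbreviation P where "P \<equiv> RI_P b a lam"
abbreviation Q where "Q \<equiv> RI_Q b a lam"
abbreviation d where "d \<equiv> RI_d a lam"
abbreviation V where "V \<equiv> RI_V b a lam"

definition M :: "complex poly \<Rightarrow> nat \<Rightarrow> complex"
  where "M p k = L (to_fract p * Q k)"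

lemma d_nz: "d m \<noteq> 0"
  using a_nz by (auto simp: RI_d_def)

lemma Q_eq: "Q m = to_fract (P m) / to_fract (d m)"
  using d_nz by (simp add: RI_Q_def Fract_conv_to_fract)

text \<open>\<open>L\<close> is linear only on \<open>V\<close>, so this membership licenses every
  use of linearity below.\<close>

lemma poly_mult_Q_in_V: "to_fract p * Q k \<in> V"
proof -
  have base: "to_fract (monom c i) * Q k \<in> V" for c i
  proof -
    have "to_fract (monom 1 i) * Q k \<in> V"
      unfolding RI_V_def by (rule ratfun.span_base) auto
    then have "ratfun_scale c (to_fract (monom 1 i) * Q k) \<in> V"
      unfolding RI_V_def by (rule ratfun.span_scale)
    moreover have "to_fract (monom c i) = to_fract [:c:] * to_fract (monom 1 i)"
      by (simp add: smult_monom flip: to_fract_mult)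
    ultimately show ?thesis by (simp add: ratfun_scale_def mult.assoc)
  qed
  have "to_fract (\<Sum>i\<in>A. monom (coeff p i) i) * Q k \<in> V" if "finite A" for A
    using that
  proof induction
    case empty then show ?case by (simp add: RI_V_def ratfun.span_zero)
  next
    case (insert i A)
    then show ?case using base[of "coeff p i" i]
      by (simp add: distrib_right) (simp add: RI_V_def ratfun.span_add)
  qed
  from this[of "{..degree p}"] show ?thesis by (simp add: poly_as_sum_of_monoms)
qed

lemma M_add: "M (p + q) k = M p k + M q k"
  using L_linear poly_mult_Q_in_V
  by (simp add: M_def distrib_right linear_functional_on_def)

lemma M_smult: "M (smult c p) k = c * M p k"
proof -
  have "to_fract (smult c p) * Q k = ratfun_scale c (to_fract p * Q k)"
    by (simp add: ratfun_scale_def flip: to_fract_mult mult.assoc)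
  then show ?thesis
    using L_linear poly_mult_Q_in_V by (simp add: M_def linear_functional_on_def)
qed

lemma M_0: "M 0 k = 0"
  using M_smult[of 0 0 k] by simp

lemma M_sum: "M (\<Sum>i\<in>A. f i) k = (\<Sum>i\<in>A. M (f i) k)"
  by (induction A rule: infinite_finite_induct) (simp_all add: M_0 M_add)

text \<open>Orthogonality kills every monomial of degree below \<open>k\<close>.\<close>

lemma M_eq_leading:
  assumes "degree p \<le> k"
  shows "M p k = coeff p k * M (monom 1 k) k"
proof -
  \<comment> \<open>The sum is padded with zero coefficients up to \<open>k\<close>, so
    \<open>degree p < k\<close> is included.\<close>
  have "M p k = M (\<Sum>i\<le>k. smult (coeff p i) (monom 1 i)) k"
    using assms by (simp add: smult_monom poly_as_sum_of_monoms')
  also have "\<dots> = (\<Sum>i\<le>k. coeff p i * M (monom 1 i) k)"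
    by (simp only: M_sum M_smult)
  also have "\<dots> = (\<Sum>i\<in>{k}. coeff p i * M (monom 1 i) k)"
    by (rule sum.mono_neutral_right) (auto simp: M_def L_orth)
  finally show ?thesis by simp
qed

text \<open>Dividing the recurrence for \<open>P (k + 2)\<close> by \<open>d (Suc k)\<close> turns
  the three terms into multiples of \<open>Q (k + 2)\<close>, \<open>Q (Suc k)\<close> and
  \<open>Q k\<close>, the last with coefficient 1.\<close>

lemma M_recurrence:
  "M (p * [:- b (Suc k), 1:]) (Suc k) = M p k + M (p * [:lam (k + 2), a (k + 2):]) (k + 2)"
proof -
  let ?u = "\<lambda>j. to_fract [:lam j, a j:]"
  have nz: "to_fract (d j) \<noteq> 0" "?u (Suc j) \<noteq> 0" for j
    using d_nz a_nz by auto
  have "to_fract (P (k + 2)) =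
      to_fract [:- b (Suc k), 1:] * to_fract (P (Suc k)) - ?u (Suc k) * to_fract (P k)"
    by (simp only: RI_P_Suc_Suc add_2_eq_Suc' to_fract_mult to_fract_diff)
  moreover have "to_fract (d (Suc j)) = to_fract (d j) * ?u (Suc j)" for j
    by (simp only: RI_d_Suc to_fract_mult)
  ultimately have "to_fract [:- b (Suc k), 1:] * Q (Suc k) = Q k + ?u (k + 2) * Q (k + 2)"
    using nz(1)[of k] nz(2)[of k] nz(2)[of "Suc k"]
    by (simp add: Q_eq divide_simps del: to_fract_eq_0_iff)
  then have "to_fract (p * [:- b (Suc k), 1:]) * Q (Suc k) =
      to_fract p * Q k + to_fract (p * [:lam (k + 2), a (k + 2):]) * Q (k + 2)"
    by (simp add: to_fract_mult algebra_simps del: mult_pCons_right)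
  then show ?thesis
    using L_linear poly_mult_Q_in_V by (simp only: M_def linear_functional_on_def)
qed

text \<open>Apply \<open>M_recurrence\<close> to \<open>x^k\<close>: the left side keeps only its
  leading term \<open>x^(k+1)\<close>, and the last term has degree at most
  \<open>k + 1 < k + 2\<close>, so it vanishes. The diagonal value thus passes from \<open>k\<close>
  to \<open>k + 1\<close>.\<close>

lemma M_monom_diagonal: "M (monom 1 k) k = 1"
proof (induction k)
  case 0 then show ?case by (simp add: M_def Q_eq RI_d_def L_one)
next
  case (Suc k)
  have deg: "degree (monom 1 k * [:c, e:]) \<le> Suc k" for c e :: complex
    using degree_mult_le[of "monom 1 k" "[:c, e:]"] degree_monom_le[of "1::complex" k]
    by (simp del: mult_pCons_right split: if_splits)
  have "coeff (monom 1 k * [:- b (Suc k), 1:]) (k + 1) = coeff (monom 1 k) k * coeff [:- b (Suc k), 1:] 1"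
    by (rule coeff_mult_top) (simp_all add: degree_monom_le)
  then have "M (monom 1 k * [:- b (Suc k), 1:]) (Suc k) = M (monom 1 (Suc k)) (Suc k)"
    by (subst M_eq_leading[OF deg]) (simp del: mult_pCons_right)
  moreover have "M (monom 1 k * [:lam (k + 2), a (k + 2):]) (k + 2) = 0"
    using deg[of "lam (k + 2)" "a (k + 2)"]
    by (subst M_eq_leading) (auto simp: coeff_eq_0 simp del: mult_pCons_right)
  ultimately show ?case using M_recurrence[of "monom 1 k" k] Suc.IH by simp
qed

lemma M_eq_coeff: "degree p \<le> k \<Longrightarrow> M p k = coeff p k"
  by (simp add: M_eq_leading M_monom_diagonal)

lemma M_P: "M (P m) k = (if m < k then 0 else \<Prod>i=Suc k..m. a i)"
proof (cases "m < k")
  case True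
  then show ?thesis using RI_P_degree_coeff[of b a lam m]
    by (simp add: M_eq_coeff coeff_eq_0)
next
  case False
  let ?e = "\<Prod>i=Suc k..m. [:lam i, a i:]"
  have P: "degree (P k) \<le> k" "coeff (P k) k = 1" using RI_P_degree_coeff by auto
  \<comment> \<open>\<open>P\<^sub>m Q\<^sub>k\<close> and \<open>P\<^sub>k Q\<^sub>m\<close> differ by the factor \<open>d\<^sub>m / d\<^sub>k\<close>, so that \<open>M_eq_coeff\<close> applies.\<close>
  have "to_fract (P m) * Q k = to_fract (P k * ?e) * Q m"
    using d_nz[of k] d_nz[of m] False by (auto simp: Q_eq RI_d_split[of k m] field_simps)
  then have "M (P m) k = M (P k * ?e) m" by (simp add: M_def)
  also have "\<dots> = coeff (P k * ?e) (k + (m - k))"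
    using degree_mult_le[of "P k" ?e] degree_prod_linear_le[of lam a k m] P False
    by (subst M_eq_coeff) auto
  also have "\<dots> = (\<Prod>i=Suc k..m. a i)"
    using P degree_prod_linear_le[of lam a k m] False
    by (subst coeff_mult_top) (auto simp: coeff_prod_linear)
  finally show ?thesis using False by simp
qed

section \<open>Path sums as values of the functional\<close>

lemma ms_sum_eq_M: "ms_sum b a lam 0 (N - int n, int m) (N, int k) = M (monom 1 n * P m) k"
proof (induction n arbitrary: m)
  case 0
  then show ?case by (simp add: ms_sum_vertical M_P)
next
  case (Suc n)
  note IHn = Suc
  show ?case
  \<comment> \<open>A vertical first step lowers \<open>m\<close> but uses up no factor
    \<open>x\<close>, which calls for this inner induction; the other steps move one column right
    and fall under \<open>IHn\<close>.\<close>
  proof (induction m)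
    case 0
    \<comment> \<open>At height 0 the convention \<open>P_{-1} = 0\<close> matches the absence of
      down steps: only up and horizontal remain.\<close>
    have "monom 1 (Suc n) = monom 1 n * P (Suc 0) + smult (b 0) (monom 1 n * P 0)"
      by (simp add: monom_Suc RI_P.simps(2))
    then have "M (monom 1 (Suc n)) k = M (monom 1 n * P (Suc 0)) k + b 0 * M (monom 1 n * P 0) k"
      by (metis M_add M_smult)
    then show ?case using IHn[of 0] IHn[of "Suc 0"]
      by (subst ms_sum_first_step) (simp_all add: ms_sum_eq_0_if_negative)
  next
    case (Suc m)
    \<comment> \<open>The four summands are the first steps up, horizontal, vertical down and
      diagonal down.\<close>
    have "monom 1 (Suc n) * P (Suc m) = monom 1 n * P (Suc (Suc m)) +
      smult (b (Suc m)) (monom 1 n * P (Suc m)) + smult (a (Suc m)) (monom 1 (Suc n) * P m) +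
      smult (lam (Suc m)) (monom 1 n * P m)"
      by (simp add: RI_P_Suc_Suc monom_Suc algebra_simps smult_diff_right)
    then have "M (monom 1 (Suc n) * P (Suc m)) k = M (monom 1 n * P (Suc (Suc m))) k +
      b (Suc m) * M (monom 1 n * P (Suc m)) k + a (Suc m) * M (monom 1 (Suc n) * P m) k +
      lam (Suc m) * M (monom 1 n * P m) k"
      by (simp only: M_add M_smult)
    then show ?case using IHn[of m] IHn[of "Suc m"] IHn[of "Suc (Suc m)"] Suc
      by (subst ms_sum_first_step) (simp_all add: nat_add_distrib algebra_simps)
  qed
qed

text \<open>The end height \<open>j\<close> is general because removing the last step raises the end
  point to \<open>j + 1\<close>. The factor with \<open>i = Suc j\<close> belongs to that step: its
  \<open>x\<close> part keeps the column and so raises \<open>n\<close>, its constant part moves one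
  column left and keeps \<open>n\<close>.\<close>

lemma ms_sum_last_down_eq_M:
  "ms_sum b a lam l (0, int m) (int (n + l), int j) =
    M (monom 1 n * P m * (\<Prod>i=Suc j..j + l. [:lam i, a i:])) (j + l)"
proof (induction l arbitrary: n j)
  case 0
  then show ?case using ms_sum_eq_M[of "int n" n m j] by simp
next
  case (Suc l)
  let ?e = "\<Prod>i=Suc (Suc j)..Suc j + l. [:lam i, a i:]"
  have "(\<Prod>i=Suc j..j + Suc l. [:lam i, a i:]) = [:lam (Suc j), a (Suc j):] * ?e"
    by (simp add: prod.atLeast_Suc_atMost del: prod.cl_ivl_Suc)
  then have "monom 1 n * P m * (\<Prod>i=Suc j..j + Suc l. [:lam i, a i:]) =
      smult (a (Suc j)) (monom 1 (Suc n) * P m * ?e) +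
      smult (lam (Suc j)) (monom 1 n * P m * ?e)"
    by (simp add: monom_Suc algebra_simps del: prod.cl_ivl_Suc)
  then have "M (monom 1 n * P m * (\<Prod>i=Suc j..j + Suc l. [:lam i, a i:])) (j + Suc l) =
      a (Suc j) * M (monom 1 (Suc n) * P m * ?e) (Suc j + l) +
      lam (Suc j) * M (monom 1 n * P m * ?e) (Suc j + l)"
    by (simp only: M_add M_smult add_Suc_right add_Suc)
  also have "\<dots> = a (Suc j) * ms_sum b a lam l (0, int m) (int (Suc n + l), int (Suc j)) +
      lam (Suc j) * ms_sum b a lam l (0, int m) (int (n + l), int (Suc j))"
    by (simp only: Suc.IH)
  also have "\<dots> = ms_sum b a lam (Suc l) (0, int m) (int (n + Suc l), int j)"
    by (subst ms_sum_last_step_down) (simp_all add: add_ac)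
  finally show ?case by simp
qed

end

theorem theorem3p18:
  fixes b a lam :: "nat \<Rightarrow> complex"
    and L :: "complex poly fract \<Rightarrow> complex"
    and n m l :: nat
  assumes a_nz: "\<And>k. k \<ge> 1 \<Longrightarrow> a k \<noteq> 0"
    and P_nz: "\<And>k. k \<ge> 1 \<Longrightarrow> poly (RI_P b a lam k) (- lam k / a k) \<noteq> 0"
    and L_linear: "linear_functional_on (RI_V b a lam) L"
    and L_one: "L 1 = 1"
    and L_orth: "\<And>i j. i < j \<Longrightarrow> L (to_fract (monom 1 i) * RI_Q b a lam j) = 0"
  shows "L (to_fract (monom 1 n * RI_P b a lam m * RI_P b a lam l)) =
    (\<Sum>\<pi> | ms_path (0, int m) \<pi> (int (n + l), 0) \<and> last_steps_down l \<pi>.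
       ms_wt b a lam (0, int m) \<pi>)"
proof -
  interpret RI_functional b a lam L
    using a_nz L_linear L_one L_orth by unfold_locales
  \<comment> \<open>Replacing \<open>P l\<close> by \<open>d l * Q l\<close> yields the product of
    \<open>ms_sum_last_down_eq_M\<close> at \<open>j = 0\<close>.\<close>
  have "to_fract (monom 1 n * P m * P l) = to_fract (monom 1 n * P m * d l) * Q l"
    using d_nz[of l] by (simp add: Q_eq)
  then have "L (to_fract (monom 1 n * P m * P l)) = M (monom 1 n * P m * d l) l"
    by (simp only: M_def)
  also have "\<dots> = ms_sum b a lam l (0, int m) (int (n + l), 0)"
    using ms_sum_last_down_eq_M[of l m n 0] by (simp add: RI_d_def)
  finally show ?thesis by (simp add: ms_sum_def)
qed

end
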